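(* Let $N$ be a positive integer and $\delta\in(0,1]$ be such that $N\geq 3^{\lfloor2/\delta\rfloor^2+\lfloor2/\delta\rfloor}$. Suppose $A\subseteq \{1,\ldots,N\}$ satisfies $|A|\geq \delta N$. Then \[R_2(A-A)\geq \frac{N^{\delta/2}}{3^{2/\delta}}.\]
   Context: $A-A=\{a-a':a,a'\in A\}$. For $L\geq 1$, a finite increasing sequence of real numbers $a_1<\cdots<a_n$ (equivalently, a finite set of reals listed in increasing order) is called $L$-regular if there is a positive real number $X$ such that $X\leq a_{i+1}-a_i\leq LX$ for all $i=1,\ldots,n-1$. For a set $B$ of real numbers, $R_L(B)=\max\{|B'|:B'\subseteq B,\ B'\text{ is }L\text{-regular}\}$. *)

theory Defs
  imports "HOL-Analysis.Analysis"
begin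

definition difference_set :: "'a::minus set \<Rightarrow> 'a set" where
  "difference_set A = {a - a' | a a'. a \<in> A \<and> a' \<in> A}"

(* sorted_list_of_set B is the strictly increasing enumeration of the finite set B
   (indexed from 0). Sets with at most one element are regular, vacuously. *)
definition is_regular :: "real \<Rightarrow> real set \<Rightarrow> bool" where
  "is_regular L B \<longleftrightarrow> finite B \<and>
     (\<exists>X>0. \<forall>i. Suc i < card B \<longrightarrow>
        X \<le> sorted_list_of_set B ! Suc i - sorted_list_of_set B ! i \<and>
        sorted_list_of_set B ! Suc i - sorted_list_of_set B ! i \<le> L * X)"

(* Meaningful for finite B: Max is taken over a finite set there, which is nonempty since
   the empty set is regular. *)
definition max_regular :: "real \<Rightarrow> real set \<Rightarrow> nat" where
  "max_regular L B = Max {card B' | B'. B' \<subseteq> B \<and> is_regular L B'}"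

end

(* If A - A misses the interval [t - h, t + h], then A + {0..h} is disjoint from its translate
   by t, so the fattened set A + {0..h'} with h' \<ge> t + h has at least twice as many elements.
   At each scale h either A - A meets all of the K intervals [6jh, 6jh + 2h], and one element
   from each gives a 2-regular set (consecutive gaps lie in [4h, 8h]), or the size of A + {0..h}
   doubles when h is replaced by 6Kh. With m = floor(2/delta), m doublings starting at h = 1
   give more than 2N elements, which do not fit into {1..N + h} if h = (6K)^m \<le> N. *)
theory Submission
  imports Defs
begin

lemma difference_set_altdef: "difference_set A = (\<lambda>(a, b). a - b) ` (A \<times> A)"
  by (auto simp: difference_set_def)

lemma finite_difference_set: "finite A \<Longrightarrow> finite (difference_set A)"
  by (simp add: difference_set_altdef)

text \<open>Gaps of at least \<open>X > 0\<close> make \<open>f\<close> strictly increasing on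
  \<open>{..<K}\<close>, so \<open>map f [0..<K]\<close> is exactly the sorted enumeration in terms
  of which \<open>is_regular\<close> is phrased.\<close>

lemma
  fixes f :: "nat \<Rightarrow> real"
  assumes "X > 0"
    and gaps: "\<And>i. Suc i < K \<Longrightarrow> X \<le> f (Suc i) - f i \<and> f (Suc i) - f i \<le> L * X"
  shows is_regular_image: "is_regular L (f ` {..<K})"
    and card_regular_image: "card (f ` {..<K}) = K"
proof -
  have less: "f i < f j" if "i < j" "j < K" for i j
    using that
  proof (induction j)
    case (Suc j)
    have "f j < f (Suc j)"
      using gaps[of j] Suc.prems \<open>X > 0\<close> by simp
    then show ?case
      using Suc by (cases "i = j") auto
  qed simp
  have inj: "inj_on f {..<K}"
    by (rule linorder_inj_onI) (use less in fastforce)+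
  then show card: "card (f ` {..<K}) = K"
    by (simp add: card_image)
  have "sorted (map f [0..<K])"
    by (auto simp: sorted_iff_nth_mono_less intro: less_imp_le less)
  moreover have "distinct (map f [0..<K])"
    using inj by (simp add: distinct_map lessThan_atLeast0)
  ultimately have "sorted_list_of_set (f ` {..<K}) = map f [0..<K]"
    by (metis sorted_list_of_set.idem_if_sorted_distinct set_map set_upt lessThan_atLeast0)
  then show "is_regular L (f ` {..<K})"
    unfolding is_regular_def card using assms by (auto intro!: exI[of _ X])
qed

lemma card_le_max_regular:
  assumes "finite B" "B' \<subseteq> B" "is_regular L B'"
  shows "card B' \<le> max_regular L B"
proof -
  have "finite {card B' | B'. B' \<subseteq> B \<and> is_regular L B'}"
    by (rule finite_subset[of _ "card ` Pow B"]) (use assms(1) in auto)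
  then show ?thesis
    unfolding max_regular_def by (rule Max_ge) (use assms in auto)
qed

definition fatten :: "int set \<Rightarrow> int \<Rightarrow> int set" where
  "fatten A h = (\<lambda>(a, s). a + s) ` (A \<times> {0..h})"

lemma finite_fatten: "finite A \<Longrightarrow> finite (fatten A h)"
  by (simp add: fatten_def)

lemma card_le_card_fatten:
  assumes "finite A" "0 \<le> h"
  shows "card A \<le> card (fatten A h)"
proof (rule card_mono[OF finite_fatten[OF assms(1)]])
  show "A \<subseteq> fatten A h"
    using assms(2) by (force simp: fatten_def)
qed

lemma card_fatten_double:
  assumes "finite A" "0 \<le> t" "t + h \<le> h'"
    and miss: "difference_set A \<inter> {t - h..t + h} = {}"
  shows "2 * card (fatten A h) \<le> card (fatten A h')"
proof -
  let ?B = "fatten A h" and ?C = "(+) t ` fatten A h"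
  have "?B \<inter> ?C = {}"
  proof (rule ccontr)
    assume "?B \<inter> ?C \<noteq> {}"
    then obtain a s b r where ab: "a \<in> A" "b \<in> A" "s \<in> {0..h}" "r \<in> {0..h}" "a + s = t + (b + r)"
      unfolding fatten_def by fast
    \<comment> \<open>Here \<open>a - b = t + (r - s)\<close>, and \<open>r - s\<close> is at most
      \<open>h\<close> in absolute value.\<close>
    then have "a - b \<in> difference_set A \<inter> {t - h..t + h}"
      by (auto simp: difference_set_def)
    with miss show False by blast
  qed
  then have "2 * card ?B = card (?B \<union> ?C)"
    using assms(1) by (simp add: card_Un_disjoint finite_fatten card_image)
  also have "\<dots> \<le> card (fatten A h')"
  proof (rule card_mono[OF finite_fatten[OF assms(1)]], rule Un_least)
    \<comment> \<open>Since \<open>t\<close> is nonnegative, \<open>t + h \<le> h'\<close> also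
      gives \<open>h \<le> h'\<close>, so the untranslated copy fits too.\<close>
    show "?B \<subseteq> fatten A h'"
      using assms(2,3) unfolding fatten_def by (intro image_mono) auto
    show "?C \<subseteq> fatten A h'"
    proof
      fix x assume "x \<in> ?C"
      then obtain a s where "x = a + (t + s)" "a \<in> A" "s \<in> {0..h}"
        by (auto simp: fatten_def)
      with assms(2,3) show "x \<in> fatten A h'"
        unfolding fatten_def by (intro image_eqI[of _ _ "(a, t + s)"]) auto
    qed
  qed
  finally show ?thesis .
qed

lemma le_max_regular_difference_set:
  assumes "finite A" "0 < h"
    and meet: "\<And>j. j < K \<Longrightarrow> difference_set A \<inter> {6 * int j * h..6 * int j * h + 2 * h} \<noteq> {}"
  shows "K \<le> max_regular 2 (real_of_int ` difference_set A)"
proof -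
  from meet have "\<forall>j. \<exists>d. j < K \<longrightarrow>
      d \<in> difference_set A \<and> 6 * int j * h \<le> d \<and> d \<le> 6 * int j * h + 2 * h"
    by fastforce
  then obtain d where d: "\<And>j. j < K \<Longrightarrow>
      d j \<in> difference_set A \<and> 6 * int j * h \<le> d j \<and> d j \<le> 6 * int j * h + 2 * h"
    by metis
  define f where "f = (\<lambda>j. real_of_int (d j))"
  \<comment> \<open>Neighbouring windows start \<open>6 * h\<close> apart and have length
    \<open>2 * h\<close>, so gaps deviate from \<open>6 * h\<close> by at most \<open>2 * h\<close>.
    The extremes \<open>4 * h\<close> and \<open>8 * h\<close> have ratio exactly 2.\<close>
  have gaps: "real_of_int (4 * h) \<le> f (Suc i) - f i \<and> f (Suc i) - f i \<le> 2 * real_of_int (4 * h)"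
    if "Suc i < K" for i
  proof -
    have "4 * h \<le> d (Suc i) - d i" "d (Suc i) - d i \<le> 2 * (4 * h)"
      using d[of i] d[of "Suc i"] that by (auto simp: algebra_simps)
    then show ?thesis
      unfolding f_def by linarith
  qed
  have "K = card (f ` {..<K})"
    using card_regular_image[of "real_of_int (4 * h)" K f 2, OF _ gaps] \<open>0 < h\<close> by simp
  also have "\<dots> \<le> max_regular 2 (real_of_int ` difference_set A)"
  proof (rule card_le_max_regular)
    show "is_regular 2 (f ` {..<K})"
      using is_regular_image[of "real_of_int (4 * h)" K f 2, OF _ gaps] \<open>0 < h\<close> by simp
  qed (use assms(1) d in \<open>auto simp: finite_difference_set f_def\<close>)
  finally show ?thesis .
qed

text \<open>The bound \<open>small\<close> does not depend on the scale, so at every scale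
  \<open>h\<close> some window is missed and a doubling step is available.\<close>

lemma card_fatten_iterate:
  assumes "finite A" and small: "max_regular 2 (real_of_int ` difference_set A) < K"
  shows "2 ^ i * card A \<le> card (fatten A ((6 * int K) ^ i))"
proof (induction i)
  case 0
  show ?case
    using card_le_card_fatten[OF assms(1), of 1] by simp
next
  case (Suc i)
  define h where "h = (6 * int K) ^ i"
  have "0 < h"
    using small by (simp add: h_def)
  then obtain j where j: "j < K"
      "difference_set A \<inter> {6 * int j * h..6 * int j * h + 2 * h} = {}"
    using le_max_regular_difference_set[OF assms(1), of h K] small by (meson not_le)
  \<comment> \<open>The missed window is centred at \<open>t = 6 * j * h + h\<close>. As
    \<open>j + 1 \<le> K\<close>, its right end \<open>t + h\<close> is at most
    \<open>6 * K * h\<close>, the next scale.\<close>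
  have "int j + 1 \<le> int K"
    using j(1) by simp
  then have "6 * ((int j + 1) * h) \<le> 6 * (int K * h)"
    using \<open>0 < h\<close> by simp
  then have "(6 * int j * h + h) + h \<le> 6 * int K * h"
    using \<open>0 < h\<close> by (simp add: algebra_simps)
  then have "2 * card (fatten A h) \<le> card (fatten A (6 * int K * h))"
    using j \<open>0 < h\<close> by (intro card_fatten_double[of A "6 * int j * h + h"] assms(1))
      (auto simp: algebra_simps)
  with Suc.IH show ?case
    by (simp add: h_def)
qed

lemma le_max_regular_of_dense:
  assumes "A \<subseteq> {1..int N}" and "2 * N < 2 ^ m * card A" and "(6 * K) ^ m \<le> N"
  shows "K \<le> max_regular 2 (real_of_int ` difference_set A)"
proof (rule ccontr)
  assume "\<not> ?thesis"
  then have "2 ^ m * card A \<le> card (fatten A ((6 * int K) ^ m))"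
    by (intro card_fatten_iterate finite_subset[OF assms(1)]) auto
  also have "\<dots> \<le> card {1..2 * int N}"
  proof (rule card_mono)
    have "(6 * int K) ^ m \<le> int N"
      using assms(3) by (metis of_nat_le_iff of_nat_mult of_nat_numeral of_nat_power)
    then show "fatten A ((6 * int K) ^ m) \<subseteq> {1..2 * int N}"
      using assms(1) by (fastforce simp: fatten_def)
  qed simp
  finally show False
    using assms(2) by simp
qed

theorem theorem2:
  fixes N :: nat and \<delta> :: real and A :: "int set"
  assumes "N > 0"
    and "0 < \<delta>" and "\<delta> \<le> 1"
    and "N \<ge> 3 ^ ((nat \<lfloor>2 / \<delta>\<rfloor>)\<^sup>2 + nat \<lfloor>2 / \<delta>\<rfloor>)"
    and "A \<subseteq> {1..int N}"
    and "real (card A) \<ge> \<delta> * real N"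
  shows "real (max_regular 2 (real_of_int ` difference_set A))
           \<ge> real N powr (\<delta> / 2) / 3 powr (2 / \<delta>)"
proof -
  define m where "m = nat \<lfloor>2 / \<delta>\<rfloor>"
  \<comment> \<open>With \<open>Q\<close> the \<open>m\<close>-th root of \<open>N\<close>, the
    requirement \<open>(6 * K) ^ m \<le> N\<close> reduces to \<open>6 * K \<le> Q\<close>.\<close>
  define Q where "Q = root m (real N)"
  define T where "T = real N powr (\<delta> / 2) / 3 powr (2 / \<delta>)"
  define K where "K = nat \<lceil>T\<rceil>"
  have "2 \<le> 2 / \<delta>"
    using assms(2,3) by (simp add: field_simps)
  then have m: "2 \<le> m" "real m \<le> 2 / \<delta>" "2 / \<delta> < real m + 1"
    unfolding m_def by linarith+
  \<comment> \<open>The exponent in the hypothesis on \<open>N\<close> factors as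
    \<open>(m + 1) * m\<close>, so taking the \<open>m\<close>-th root gives
    \<open>Q \<ge> 3 ^ (m + 1)\<close>.\<close>
  have "3 ^ ((m + 1) * m) \<le> real N"
    using assms(4) unfolding m_def[symmetric]
    by (metis (no_types, lifting) add.commute add_mult_distrib mult_1 of_nat_le_iff of_nat_numeral
        of_nat_power power2_eq_square)
  then have "root m ((3 ^ (m + 1)) ^ m) \<le> Q"
    unfolding Q_def power_mult using m by (intro real_root_le_mono) auto
  then have "3 ^ (m + 1) \<le> Q"
    using m by (subst (asm) real_root_power_cancel) auto
  moreover have "(3::real) ^ 3 \<le> 3 ^ (m + 1)"
    using m by (intro power_increasing) auto
  ultimately have "27 \<le> Q"
    by simp
  have "\<delta> / 2 \<le> 1 / real m"
    using m assms(2) by (simp add: field_simps)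
  then have "real N powr (\<delta> / 2) \<le> Q"
    using m \<open>N > 0\<close> by (simp add: Q_def root_powr_inverse powr_mono)
  moreover have "9 \<le> (3::real) powr (2 / \<delta>)"
    using powr_mono[OF \<open>2 \<le> 2 / \<delta>\<close>, of 3] by simp
  ultimately have "T \<le> Q / 9"
    unfolding T_def using \<open>27 \<le> Q\<close> by (intro frac_le) auto
  moreover have "T > 0"
    using \<open>N > 0\<close> by (simp add: T_def)
  \<comment> \<open>Rounding up costs less than 1, so
    \<open>6 * K < 6 * T + 6 \<le> 2 * Q / 3 + 6\<close>, and \<open>6 \<le> Q / 3\<close> because
    \<open>Q \<ge> 27\<close>.\<close>
  ultimately have "6 * real K \<le> Q"
    using \<open>27 \<le> Q\<close> unfolding K_def by linarith
  then have "(6 * real K) ^ m \<le> Q ^ m"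
    by (intro power_mono) auto
  also have "Q ^ m = real N"
    unfolding Q_def using m by simp
  finally have K: "(6 * K) ^ m \<le> N"
    by (metis of_nat_le_iff of_nat_mult of_nat_numeral of_nat_power)
  \<comment> \<open>Bernoulli for \<open>(1 + 1) ^ m\<close> turns
    \<open>2 / \<delta> < m + 1\<close> into \<open>2 / \<delta> < 2 ^ m\<close>: \<open>m\<close>
    doublings outweigh the density \<open>\<delta>\<close>.\<close>
  have pow: "real m + 1 \<le> 2 ^ m"
    using Bernoulli_inequality[of "1::real" m] by simp
  have "2 / \<delta> < 2 ^ m"
    by (rule less_le_trans[OF m(3) pow])
  then have "2 * real N < 2 ^ m * (\<delta> * real N)"
    using assms(1,2) by (simp add: field_simps)
  also have "\<dots> \<le> 2 ^ m * real (card A)"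
    using assms(6) by simp
  finally have "real (2 * N) < real (2 ^ m * card A)"
    by simp
  then have "2 * N < 2 ^ m * card A"
    by (simp only: of_nat_less_iff)
  then have "K \<le> max_regular 2 (real_of_int ` difference_set A)"
    using assms(5) K by (intro le_max_regular_of_dense)
  then have "T \<le> real (max_regular 2 (real_of_int ` difference_set A))"
    unfolding K_def by (simp add: nat_le_iff ceiling_le_iff)
  then show ?thesis
    unfolding T_def .
qed

end
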